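(* By using threshold payments, Random-EOM$(0.5,A,B)$ is universally truthful, budget feasible, and a $4$ approximation of the optimum, i.e. $4\,E[v(S)]\ge opt(A,B)$ where $S$ is its (random) winning set.
   Context: Setting. A buyer with budget $B>0$ faces a finite set $A$ of $n$ sellers. Seller $i$ owns one item (also called $i$) and has a private cost $c_i\ge 0$; his utility when selling at payment $p_i$ is $p_i-c_i$. The buyer's value $v:2^A\to\mathbb{R}_{\ge 0}$ is monotone non-decreasing and submodular. Write $v(i)=v(\{i\})$, $m_i(S)=v(S\cup\{i\})-v(S)$, $c(S)=\sum_{i\in S}c_i$, and $opt(A,B)=\max\{v(S):S\subseteq A,\ c(S)\le B\}$. Mechanisms. A deterministic allocation rule $f$ maps each declared cost vector $c$ to a winning set $f(c)\subseteq A$. Threshold payments: a winner $i$ is paid $p_i=\inf\{b: i\notin f(b,c_{-i})\}$, losers are paid $0$. A deterministic mechanism is truthful if declaring the true cost is always a dominant strategy for each seller; a randomized mechanism is universally truthful if it is a randomization over truthful deterministic mechanisms. It is budget feasible if for every cost vector (and every realization of the randomness) the total payment is at most $B$. Greedy order. $S_0=\emptyset$ and $S_i=S_{i-1}\cup\{\arg\max_{j\in A\setminus S_{i-1}} m_j(S_{i-1})/c_j\}$, ties broken by a fixed order on sellers; the ratio is $0$ if $m_j(S_{i-1})=0$ and $+\infty$ if $c_j=0<m_j(S_{i-1})$. Items are renamed so that $S_i\setminus S_{i-1}=\{i\}$. Greedy-EOM$(\alpha,A,B)$: let $v^*=opt(A,B)$ and $k=1$; while $k\le|A|$ and $v(S_k)\le\alpha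 v^*$ increase $k$ by one; return $S_{k-1}$. Random-EOM$(\alpha,A,B)$: replace $A$ by $\{i\in A:c_i\le B\}$ (return $\emptyset$ if this is empty); let $i^*\in\arg\max_{i\in A}v(i)$; with probability $\frac12$ return Greedy-EOM$(\alpha,A,B)$, otherwise return $\{i^*\}$.
   Formalization: Budget feasibility is claimed only when at most one seller has v(i)=0; with two such sellers affordable and the others priced above B, opt is 0, both win at every bid up to B, and threshold payments total 2B. *)

theory Defs
  imports "HOL-Probability.Probability" "HOL-Library.While_Combinator"
begin

definition submodular_on :: "'a set \<Rightarrow> ('a set \<Rightarrow> real) \<Rightarrow> bool" where
  "submodular_on A v \<longleftrightarrow>
     (\<forall>S T. S \<subseteq> A \<longrightarrow> T \<subseteq> A \<longrightarrow> v (S \<union> T) + v (S \<inter> T) \<le> v S + v T)"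

text \<open>Cost vectors are total functions; only their values on \<open>A\<close> matter.\<close>

definition cost_vectors :: "'a set \<Rightarrow> ('a \<Rightarrow> real) set" where
  "cost_vectors A = {c. \<forall>i\<in>A. 0 \<le> c i}"

definition opt :: "'a set \<Rightarrow> ('a set \<Rightarrow> real) \<Rightarrow> ('a \<Rightarrow> real) \<Rightarrow> real \<Rightarrow> real" where
  "opt A v c B = Max {v S | S. S \<subseteq> A \<and> sum c S \<le> B}"


subsection \<open>Mechanisms\<close>

type_synonym 'a rule = "('a \<Rightarrow> real) \<Rightarrow> 'a set"

datatype 'a mechanism =
  Mechanism (alloc: "'a rule") (pay: "('a \<Rightarrow> real) \<Rightarrow> 'a \<Rightarrow> real")

text \<open>The infimum ranges over the legal (nonnegative) bids at which \<open>i\<close> loses. On the reals it is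
  meaningful only if there is such a bid; this holds for both rules below, where every bid
  above \<open>B\<close> loses.\<close>

definition threshold_payment :: "'a rule \<Rightarrow> ('a \<Rightarrow> real) \<Rightarrow> 'a \<Rightarrow> real" where
  "threshold_payment f c i =
     (if i \<in> f c then Inf {b. 0 \<le> b \<and> i \<notin> f (c(i := b))} else 0)"

definition with_threshold_payments :: "'a rule \<Rightarrow> 'a mechanism" where
  "with_threshold_payments f = Mechanism f (threshold_payment f)"

definition utility :: "'a mechanism \<Rightarrow> 'a \<Rightarrow> real \<Rightarrow> ('a \<Rightarrow> real) \<Rightarrow> real" where
  "utility M i true_cost c = pay M c i - (if i \<in> alloc M c then true_cost else 0)"

text \<open>In \<open>c\<close> seller \<open>i\<close> declares the true cost \<open>c i\<close>; the declarations of the others are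
  arbitrary.\<close>

definition truthful :: "'a set \<Rightarrow> 'a mechanism \<Rightarrow> bool" where
  "truthful A M \<longleftrightarrow>
     (\<forall>c\<in>cost_vectors A. \<forall>i\<in>A. \<forall>b\<ge>0. utility M i (c i) (c(i := b)) \<le> utility M i (c i) c)"

text \<open>A randomized mechanism is a distribution over deterministic ones.\<close>

definition universally_truthful :: "'a set \<Rightarrow> 'a mechanism pmf \<Rightarrow> bool" where
  "universally_truthful A R \<longleftrightarrow> (\<forall>M\<in>set_pmf R. truthful A M)"

definition budget_feasible :: "'a set \<Rightarrow> real \<Rightarrow> 'a mechanism pmf \<Rightarrow> bool" where
  "budget_feasible A B R \<longleftrightarrow>
     (\<forall>c\<in>cost_vectors A. \<forall>M\<in>set_pmf R. (\<Sum>i\<in>A. pay M c i) \<le> B)"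

definition approximates_opt ::
  "real \<Rightarrow> 'a set \<Rightarrow> ('a set \<Rightarrow> real) \<Rightarrow> real \<Rightarrow> 'a mechanism pmf \<Rightarrow> bool" where
  "approximates_opt \<rho> A v B R \<longleftrightarrow>
     (\<forall>c\<in>cost_vectors A. \<rho> * measure_pmf.expectation R (\<lambda>M. v (alloc M c)) \<ge> opt A v c B)"


subsection \<open>The greedy and the random mechanism\<close>

definition marginal :: "('a set \<Rightarrow> real) \<Rightarrow> 'a \<Rightarrow> 'a set \<Rightarrow> real" where
  "marginal v i S = v (S \<union> {i}) - v S"

definition ratio :: "('a set \<Rightarrow> real) \<Rightarrow> ('a \<Rightarrow> real) \<Rightarrow> 'a set \<Rightarrow> 'a \<Rightarrow> ereal" where
  "ratio v c S j =
     (if marginal v j S = 0 then 0 else if c j = 0 then \<infinity> else ereal (marginal v j S / c j))"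

text \<open>Ties are broken by the linear order of the type of sellers.\<close>

definition greedy_pick ::
  "'a::linorder set \<Rightarrow> ('a set \<Rightarrow> real) \<Rightarrow> ('a \<Rightarrow> real) \<Rightarrow> 'a set \<Rightarrow> 'a" where
  "greedy_pick A v c S = Min {j. is_arg_max (ratio v c S) (\<lambda>j. j \<in> A - S) j}"

text \<open>Only the sets with index at most \<open>card A\<close> are meaningful (and used).\<close>

fun greedy_set ::
  "'a::linorder set \<Rightarrow> ('a set \<Rightarrow> real) \<Rightarrow> ('a \<Rightarrow> real) \<Rightarrow> nat \<Rightarrow> 'a set" where
  "greedy_set A v c 0 = {}"
| "greedy_set A v c (Suc k) = greedy_set A v c k \<union> {greedy_pick A v c (greedy_set A v c k)}"

definition greedy_eom ::
  "real \<Rightarrow> 'a::linorder set \<Rightarrow> ('a set \<Rightarrow> real) \<Rightarrow> real \<Rightarrow> 'a rule" where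
  "greedy_eom \<alpha> A v B c =
     (let k = while (\<lambda>k. k \<le> card A \<and> v (greedy_set A v c k) \<le> \<alpha> * opt A v c B) Suc 1
      in greedy_set A v c (k - 1))"

text \<open>Here \<open>best X\<close> is the chosen maximizer of \<open>v {i}\<close> over \<open>i \<in> X\<close>. How ties are resolved is left
  open, but the choice may depend only on the set of affordable sellers, not on their costs.\<close>

definition best_single :: "'a set \<Rightarrow> ('a set \<Rightarrow> real) \<Rightarrow> ('a set \<Rightarrow> 'a) \<Rightarrow> bool" where
  "best_single A v best \<longleftrightarrow>
     (\<forall>X. X \<subseteq> A \<longrightarrow> X \<noteq> {} \<longrightarrow> is_arg_max (\<lambda>i. v {i}) (\<lambda>i. i \<in> X) (best X))"

definition random_eom_rule ::
  "real \<Rightarrow> 'a::linorder set \<Rightarrow> ('a set \<Rightarrow> real) \<Rightarrow> real \<Rightarrow> ('a set \<Rightarrow> 'a) \<Rightarrow> bool \<Rightarrow> 'a rule" where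
  "random_eom_rule \<alpha> A v B best coin c =
     (let A' = {i \<in> A. c i \<le> B} in
      if A' = {} then {} else if coin then greedy_eom \<alpha> A' v B c else {best A'})"

definition random_eom ::
  "real \<Rightarrow> 'a::linorder set \<Rightarrow> ('a set \<Rightarrow> real) \<Rightarrow> real \<Rightarrow> ('a set \<Rightarrow> 'a) \<Rightarrow> 'a rule pmf" where
  "random_eom \<alpha> A v B best = map_pmf (random_eom_rule \<alpha> A v B best) (bernoulli_pmf (1 / 2))"

text \<open>A caveat on budget feasibility. If two sellers \<open>i\<close> with \<open>v {i} = 0\<close> are the only affordable
  ones, then \<open>opt\<close> is \<open>0\<close>, the greedy loop never meets its stopping test, and both
  sellers win at every bid up to \<open>B\<close>, so the threshold payments add up to \<open>2 * B\<close>. Hence budget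
  feasibility can only be claimed when at most one seller is worthless in this sense.\<close>

end

theory Submission imports Defs begin

text \<open>
  Raising the bid of seller \<open>i\<close> does not change the greedy picks made before \<open>i\<close> and can only lower
  the optimum, so both rules are monotone and threshold payments make them truthful. For the
  budget, let \<open>i\<close> still win with a bid \<open>b\<close> above its cost and be picked after \<open>T\<close>. Comparing \<open>T\<close> with an
  optimal set for the \<^emph>\<open>original\<close> costs, where \<open>i\<close> itself contributes at most its own marginal value,
  gives \<open>b \<cdot> opt / 2 \<le> B \<cdot> m\<^sub>i(T)\<close>; the marginal values of the winners telescope to at most \<open>opt / 2\<close>.
  For the approximation, the first rejected item raises the greedy value above \<open>opt / 2\<close> and is
  worth at most as much as the best single item.
\<close>

section \<open>Threshold payments\<close>

text \<open>Each bid \<open>X + e\<close> with \<open>e > 0\<close> loses, so it belongs to the set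
  whose infimum is the payment. In this form a payment is bounded by inspecting winning bids
  only.\<close>

lemma threshold_payment_le:
  assumes win: "i \<in> f c" and "0 \<le> c i"
    and bound: "\<And>b. c i \<le> b \<Longrightarrow> i \<in> f (c(i := b)) \<Longrightarrow> b \<le> X"
  shows "threshold_payment f c i \<le> X"
proof (rule field_le_epsilon)
  fix e :: real assume "0 < e"
  have "c i \<le> X" using bound[of "c i"] win by simp
  then have "i \<notin> f (c(i := X + e))" using bound[of "X + e"] \<open>0 < e\<close> by fastforce
  then have "X + e \<in> {b. 0 \<le> b \<and> i \<notin> f (c(i := b))}"
    using \<open>0 \<le> c i\<close> \<open>c i \<le> X\<close> \<open>0 < e\<close> by simp
  moreover have "bdd_below {b. 0 \<le> b \<and> i \<notin> f (c(i := b))}" by (rule bdd_belowI[of _ 0]) simp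
  ultimately have "Inf {b. 0 \<le> b \<and> i \<notin> f (c(i := b))} \<le> X + e" by (rule cInf_lower)
  then show "threshold_payment f c i \<le> X + e" using win by (simp add: threshold_payment_def)
qed

lemma cost_vectors_upd: "c \<in> cost_vectors A \<Longrightarrow> 0 \<le> b \<Longrightarrow> c(i := b) \<in> cost_vectors A"
  by (auto simp: cost_vectors_def)

text \<open>Myerson's argument: the set \<open>L\<close> of losing bids of \<open>i\<close> does not
  depend on the bid of \<open>i\<close>, so every bid yields either \<open>Inf L - c i\<close> or
  \<open>0\<close>. Monotonicity makes the truthful bid select the larger of the two;
  \<open>loses\<close> keeps \<open>L\<close> nonempty, so that its infimum is meaningful.\<close>

lemma truthful_with_threshold_payments:
  assumes mono: "\<And>c i b. c \<in> cost_vectors A \<Longrightarrow> i \<in> A \<Longrightarrow> c i \<le> b \<Longrightarrow> i \<in> f (c(i := b)) \<Longrightarrow> i \<in> f c"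
    and loses: "\<And>c i. c \<in> cost_vectors A \<Longrightarrow> i \<in> A \<Longrightarrow> \<exists>b\<ge>0. i \<notin> f (c(i := b))"
  shows "truthful A (with_threshold_payments f)"
  unfolding truthful_def
proof (intro ballI allI impI)
  fix c i and b :: real
  assume c: "c \<in> cost_vectors A" and i: "i \<in> A" and b: "0 \<le> b"
  define L where "L = {b. 0 \<le> b \<and> i \<notin> f (c(i := b))}"
  have ci: "0 \<le> c i" using c i by (auto simp: cost_vectors_def)
  have pay: "threshold_payment f (c(i := x)) i = (if i \<in> f (c(i := x)) then Inf L else 0)" for x
    by (simp add: threshold_payment_def L_def)
  have util: "utility (with_threshold_payments f) i (c i) (c(i := x))
      = (if i \<in> f (c(i := x)) then Inf L - c i else 0)" for x
    by (simp add: utility_def with_threshold_payments_def pay)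
  have wins: "c i \<le> Inf L" if "i \<in> f c"
  proof (rule cInf_greatest)
    show "L \<noteq> {}" using loses[OF c i] by (auto simp: L_def)
    fix x assume x: "x \<in> L"
    show "c i \<le> x"
    proof (rule ccontr)
      assume "\<not> c i \<le> x"
      \<comment> \<open>Monotonicity is applied to the vector with bid \<open>x\<close>, from which
        \<open>c\<close> arises by raising that bid to \<open>c i\<close>.\<close>
      then have "i \<in> f (c(i := x))"
        using mono[of "c(i := x)" i "c i"] cost_vectors_upd[OF c, of x i] x i that by (simp add: L_def)
      then show False using x by (simp add: L_def)
    qed
  qed
  have "Inf L \<le> c i" if "i \<notin> f c"
    using that ci by (intro cInf_lower bdd_belowI[of _ 0]) (auto simp: L_def)
  with wins show "utility (with_threshold_payments f) i (c i) (c(i := b))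
      \<le> utility (with_threshold_payments f) i (c i) c"
    using util[of b] util[of "c i"] by auto
qed

section \<open>Monotone submodular functions\<close>

locale monotone_submodular =
  fixes A :: "'a::linorder set" and v :: "'a set \<Rightarrow> real"
  assumes fin: "finite A"
    and mono: "mono_on (Pow A) v"
    and submod: "submodular_on A v"
begin

text \<open>Lets the results of this locale be applied to the affordable sellers in place of
  \<open>A\<close>.\<close>

lemma restrict: "X \<subseteq> A \<Longrightarrow> monotone_submodular X v"
  using fin mono submod
  by unfold_locales (auto simp: submodular_on_def intro: finite_subset mono_on_subset)

lemma v_mono: "S \<subseteq> T \<Longrightarrow> T \<subseteq> A \<Longrightarrow> v S \<le> v T"
  using mono by (auto simp: mono_on_def)

lemma marginal_nonneg: "S \<subseteq> A \<Longrightarrow> j \<in> A \<Longrightarrow> 0 \<le> marginal v j S"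
  using v_mono[of S "S \<union> {j}"] by (auto simp: marginal_def)

text \<open>Submodularity is applied to \<open>S \<union> {j}\<close> and \<open>T\<close>, which
  meet in \<open>S\<close> unless \<open>j\<close> lies in \<open>T\<close>; in that case the left
  side is \<open>0\<close>.\<close>

lemma marginal_antimono:
  assumes "S \<subseteq> T" "T \<subseteq> A" "j \<in> A"
  shows "marginal v j T \<le> marginal v j S"
proof (cases "j \<in> T")
  case True
  then show ?thesis using marginal_nonneg[of S j] assms by (simp add: marginal_def insert_absorb)
next
  case False
  have "v ((S \<union> {j}) \<union> T) + v ((S \<union> {j}) \<inter> T) \<le> v (S \<union> {j}) + v T"
    using submod assms unfolding submodular_on_def by (meson Un_least empty_subsetI insert_subset subset_trans)
  moreover have "(S \<union> {j}) \<union> T = T \<union> {j}" "(S \<union> {j}) \<inter> T = S" using assms False by auto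
  ultimately show ?thesis by (simp add: marginal_def)
qed

text \<open>The elements of \<open>X\<close> are added one at a time, and each gains at most what it
  would gain on top of \<open>T\<close> alone.\<close>

lemma v_Un_le_sum_marginal:
  assumes "T \<subseteq> A" "X \<subseteq> A"
  shows "v (T \<union> X) \<le> v T + (\<Sum>j\<in>X. marginal v j T)"
proof -
  have "finite X" using assms fin finite_subset by blast
  then show ?thesis using \<open>X \<subseteq> A\<close>
  proof (induction X)
    case (insert x X)
    have "marginal v x (T \<union> X) \<le> marginal v x T"
      using insert.prems assms by (intro marginal_antimono) auto
    moreover have "v (T \<union> insert x X) = v (T \<union> X) + marginal v x (T \<union> X)"
      by (simp add: marginal_def)
    ultimately show ?case using insert by simp
  qed simp
qed

lemma v_le_sum_marginal:
  assumes "T \<subseteq> A" "X \<subseteq> A"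
  shows "v X \<le> v T + (\<Sum>j\<in>X - T. marginal v j T)"
proof -
  have "v X \<le> v (T \<union> (X - T))" using assms by (intro v_mono) auto
  also have "\<dots> \<le> v T + (\<Sum>j\<in>X - T. marginal v j T)" using assms by (intro v_Un_le_sum_marginal) auto
  finally show ?thesis .
qed

section \<open>The optimum\<close>

lemma opt_ge:
  assumes "S \<subseteq> A" "sum c S \<le> B"
  shows "v S \<le> opt A v c B"
  unfolding opt_def using assms fin by (intro Max_ge) auto

lemma opt_attained:
  assumes "0 \<le> B"
  obtains S where "S \<subseteq> A" "sum c S \<le> B" "opt A v c B = v S"
proof -
  let ?V = "{v S | S. S \<subseteq> A \<and> sum c S \<le> B}"
  have "finite ?V" using fin by auto
  moreover have "v {} \<in> ?V" using assms by force
  ultimately have "Max ?V \<in> ?V" by (intro Max_in) auto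
  then show ?thesis using that by (auto simp: opt_def)
qed

lemma opt_antimono:
  assumes "0 \<le> B" "\<And>i. i \<in> A \<Longrightarrow> c i \<le> c' i"
  shows "opt A v c' B \<le> opt A v c B"
proof -
  obtain S where S: "S \<subseteq> A" "sum c' S \<le> B" "opt A v c' B = v S" using opt_attained assms(1) .
  have "sum c S \<le> sum c' S" using S assms(2) by (intro sum_mono) auto
  with S show ?thesis by (simp add: opt_ge)
qed

text \<open>Costs are nonnegative, so a seller above the budget occurs in no feasible set.\<close>

lemma opt_affordable:
  assumes "c \<in> cost_vectors A"
  shows "opt {i \<in> A. c i \<le> B} v c B = opt A v c B"
proof -
  have "c i \<le> B" if "S \<subseteq> A" "sum c S \<le> B" "i \<in> S" for S i
  proof -
    have "c i \<le> sum c S"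
      using that assms fin by (intro member_le_sum) (auto simp: cost_vectors_def intro: finite_subset)
    with that show ?thesis by simp
  qed
  then have "S \<subseteq> {i \<in> A. c i \<le> B} \<and> sum c S \<le> B \<longleftrightarrow> S \<subseteq> A \<and> sum c S \<le> B" for S by blast
  then show ?thesis by (simp add: opt_def)
qed

section \<open>The greedy order\<close>

lemma ratio_antimono:
  assumes "S \<subseteq> A" "j \<in> A" "0 \<le> c i" "c i \<le> b"
  shows "ratio v (c(i := b)) S j \<le> ratio v c S j"
  using assms marginal_nonneg[of S j]
  by (auto simp: ratio_def fun_upd_apply intro: divide_left_mono mult_pos_pos)

lemma arg_max_set:
  fixes c :: "'a \<Rightarrow> real"
  assumes "S \<subset> A"
  defines "M \<equiv> {j. is_arg_max (ratio v c S) (\<lambda>j. j \<in> A - S) j}"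
  shows "finite M" "M \<noteq> {}"
proof -
  show "finite M" using fin by (auto simp: M_def is_arg_max_def)
  have "finite (ratio v c S ` (A - S))" "ratio v c S ` (A - S) \<noteq> {}" using assms fin by auto
  then obtain j where "j \<in> A - S" "ratio v c S j = Max (ratio v c S ` (A - S))"
    using Max_in[of "ratio v c S ` (A - S)"] by (metis imageE)
  then have "j \<in> M" using fin by (simp add: M_def is_arg_max_linorder)
  then show "M \<noteq> {}" by auto
qed

lemma greedy_pick:
  assumes "S \<subset> A"
  shows "greedy_pick A v c S \<in> A - S"
    and "j \<in> A - S \<Longrightarrow> ratio v c S j \<le> ratio v c S (greedy_pick A v c S)"
proof -
  have "greedy_pick A v c S \<in> {j. is_arg_max (ratio v c S) (\<lambda>j. j \<in> A - S) j}"
    unfolding greedy_pick_def using arg_max_set[OF assms] by (rule Min_in)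
  then show "greedy_pick A v c S \<in> A - S"
    and "j \<in> A - S \<Longrightarrow> ratio v c S j \<le> ratio v c S (greedy_pick A v c S)"
    by (simp_all add: is_arg_max_linorder)
qed

text \<open>The old pick keeps its ratio while no other ratio grows, so it stays a maximizer.
  Conversely, every maximizer for the new costs was one before, so the tie-breaking minimum stays
  the same.\<close>

lemma greedy_pick_upd:
  assumes S: "S \<subset> A" and ci: "0 \<le> c i" "c i \<le> b" and ne: "greedy_pick A v c S \<noteq> i"
  shows "greedy_pick A v (c(i := b)) S = greedy_pick A v c S"
proof -
  let ?c' = "c(i := b)" and ?p = "greedy_pick A v c S"
  have same: "ratio v ?c' S ?p = ratio v c S ?p" using ne by (simp add: ratio_def)
  have le: "ratio v ?c' S j \<le> ratio v c S j" if "j \<in> A - S" for j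
    using S ci that by (intro ratio_antimono) auto
  have p: "ratio v c S j \<le> ratio v c S ?p" if "j \<in> A - S" for j
    using S that by (rule greedy_pick(2))
  show ?thesis
    unfolding greedy_pick_def[of A v ?c']
  proof (rule Min_eqI)
    show "finite {j. is_arg_max (ratio v ?c' S) (\<lambda>j. j \<in> A - S) j}" using arg_max_set[OF S] by blast
    have "ratio v ?c' S j \<le> ratio v ?c' S ?p" if "j \<in> A - S" for j
      unfolding same using le[OF that] p[OF that] by (rule order_trans)
    then show "?p \<in> {j. is_arg_max (ratio v ?c' S) (\<lambda>j. j \<in> A - S) j}"
      using greedy_pick(1)[OF S, of c] by (simp add: is_arg_max_linorder del: fun_upd_apply)
    fix j assume "j \<in> {j. is_arg_max (ratio v ?c' S) (\<lambda>j. j \<in> A - S) j}"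
    then have j: "j \<in> A - S" "ratio v ?c' S ?p \<le> ratio v ?c' S j"
      using greedy_pick(1)[OF S, of c] by (simp_all add: is_arg_max_linorder del: fun_upd_apply)
    have "ratio v c S ?p \<le> ratio v c S j"
      using j(2) le[OF j(1)] unfolding same by (rule order_trans)
    then have "\<forall>x\<in>A - S. ratio v c S x \<le> ratio v c S j" using p order_trans by blast
    then have "j \<in> {j. is_arg_max (ratio v c S) (\<lambda>j. j \<in> A - S) j}"
      using j(1) by (simp add: is_arg_max_linorder)
    then show "?p \<le> j" unfolding greedy_pick_def using arg_max_set[OF S] by (intro Min_le)
  qed
qed

lemma greedy_set_subset_card: "k \<le> card A \<Longrightarrow> greedy_set A v c k \<subseteq> A \<and> card (greedy_set A v c k) = k"
proof (induction k)
  case (Suc k)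
  then have "greedy_set A v c k \<subset> A" by auto
  from greedy_pick(1)[OF this, of c] Suc show ?case
    using fin by (auto simp: card_insert_if dest: finite_subset)
qed simp

lemma greedy_set_subset: "k \<le> card A \<Longrightarrow> greedy_set A v c k \<subseteq> A"
  by (simp add: greedy_set_subset_card)

lemma greedy_set_psubset: "k < card A \<Longrightarrow> greedy_set A v c k \<subset> A"
  using greedy_set_subset_card[of k c] by auto

lemma greedy_set_pick:
  "k < card A \<Longrightarrow> greedy_pick A v c (greedy_set A v c k) \<in> A - greedy_set A v c k"
  by (intro greedy_pick(1) greedy_set_psubset)

lemma greedy_set_card: "greedy_set A v c (card A) = A"
  using greedy_set_subset_card[of "card A" c] card_subset_eq[OF fin] by blast

lemma greedy_set_mono: "k \<le> l \<Longrightarrow> greedy_set A v c k \<subseteq> greedy_set A v c l"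
  by (rule lift_Suc_mono_le) auto

lemma greedy_set_position:
  "i \<in> greedy_set A v c m \<Longrightarrow>
     \<exists>k<m. i \<notin> greedy_set A v c k \<and> greedy_pick A v c (greedy_set A v c k) = i"
proof (induction m)
  case (Suc m)
  then show ?case by (cases "i \<in> greedy_set A v c m") (auto intro: less_SucI)
qed simp

lemma greedy_set_upd:
  assumes "0 \<le> c i" "c i \<le> b"
  shows "k \<le> card A \<Longrightarrow> i \<notin> greedy_set A v c k \<Longrightarrow> greedy_set A v (c(i := b)) k = greedy_set A v c k"
proof (induction k)
  case (Suc k)
  then have "greedy_pick A v (c(i := b)) (greedy_set A v c k) = greedy_pick A v c (greedy_set A v c k)"
    using assms greedy_set_psubset[of k c] by (intro greedy_pick_upd) auto
  with Suc show ?case by (simp del: fun_upd_apply)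
qed simp

text \<open>A higher bid can only delay \<open>i\<close>: both runs coincide up to the moment
  \<open>k\<close> at which the lower bid gets \<open>i\<close> picked.\<close>

lemma greedy_position_upd:
  assumes ci: "0 \<le> c i" "c i \<le> b" and l: "l < card A"
    and pick: "greedy_pick A v (c(i := b)) (greedy_set A v (c(i := b)) l) = i"
  obtains k where "k \<le> l" "greedy_pick A v c (greedy_set A v c k) = i"
    "greedy_set A v c k \<subseteq> greedy_set A v (c(i := b)) l"
proof -
  let ?c' = "c(i := b)"
  have "i \<in> A" using greedy_set_pick[OF l, of ?c'] pick by simp
  then obtain k where k: "k < card A" "i \<notin> greedy_set A v c k" "greedy_pick A v c (greedy_set A v c k) = i"
    using greedy_set_position[of i c "card A"] greedy_set_card by auto
  have eq: "greedy_set A v ?c' k = greedy_set A v c k" using greedy_set_upd[of c i b k] ci k by simp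
  have "i \<in> greedy_set A v ?c' (Suc l)" using pick by simp
  \<comment> \<open>Otherwise \<open>i\<close> would already belong to the common prefix of length
    \<open>k\<close>.\<close>
  then have "\<not> Suc l \<le> k" using greedy_set_mono[of "Suc l" k ?c'] k eq by blast
  then have "k \<le> l" by simp
  with that[of k] k eq greedy_set_mono[of k l ?c'] show thesis by simp
qed

text \<open>Replaces the loop by its outcome. The bounds start at index \<open>1\<close> because the
  loop never tests the empty set; \<open>m = card A\<close> is the exit by exhaustion of the
  sellers.\<close>

lemma greedy_eom_prefix:
  "\<exists>m\<le>card A. greedy_eom \<alpha> A v B c = greedy_set A v c m
    \<and> (\<forall>k. 1 \<le> k \<longrightarrow> k \<le> m \<longrightarrow> v (greedy_set A v c k) \<le> \<alpha> * opt A v c B)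
    \<and> (m < card A \<longrightarrow> \<alpha> * opt A v c B < v (greedy_set A v c (Suc m)))"
proof -
  let ?b = "\<lambda>k. k \<le> card A \<and> v (greedy_set A v c k) \<le> \<alpha> * opt A v c B"
  let ?I = "\<lambda>k. 1 \<le> k \<and> k \<le> Suc (card A) \<and> (\<forall>j. 1 \<le> j \<and> j < k \<longrightarrow> v (greedy_set A v c j) \<le> \<alpha> * opt A v c B)"
  define w where "w = while ?b Suc 1"
  have "?I w \<and> \<not> ?b w" unfolding w_def
  proof (rule while_rule[where P = ?I and r = "Wellfounded.measure (\<lambda>k. Suc (card A) - k)"])
    show "?I (Suc s)" if "?I s" "?b s" for s using that by (auto simp: less_Suc_eq)
  qed auto
  moreover have "greedy_eom \<alpha> A v B c = greedy_set A v c (w - 1)"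
    by (simp only: greedy_eom_def w_def Let_def)
  ultimately show ?thesis by (intro exI[of _ "w - 1"]) auto
qed

text \<open>The values of the greedy sets increase, so whether \<open>i\<close> wins is decided by
  the single test made right after \<open>i\<close> is picked.\<close>

lemma greedy_eom_iff:
  "i \<in> greedy_eom \<alpha> A v B c \<longleftrightarrow> (\<exists>k<card A. greedy_pick A v c (greedy_set A v c k) = i
     \<and> v (greedy_set A v c (Suc k)) \<le> \<alpha> * opt A v c B)"
proof -
  obtain m where m: "m \<le> card A" "greedy_eom \<alpha> A v B c = greedy_set A v c m"
    "\<And>k. 1 \<le> k \<Longrightarrow> k \<le> m \<Longrightarrow> v (greedy_set A v c k) \<le> \<alpha> * opt A v c B"
    "m < card A \<Longrightarrow> \<alpha> * opt A v c B < v (greedy_set A v c (Suc m))"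
    using greedy_eom_prefix[of \<alpha> B c] by blast
  show ?thesis
  proof
    assume "i \<in> greedy_eom \<alpha> A v B c"
    then obtain k where "k < m" "greedy_pick A v c (greedy_set A v c k) = i"
      using greedy_set_position[of i c m] m(2) by auto
    then show "\<exists>k<card A. greedy_pick A v c (greedy_set A v c k) = i
        \<and> v (greedy_set A v c (Suc k)) \<le> \<alpha> * opt A v c B"
      using m(1) m(3)[of "Suc k"] by (intro exI[of _ k]) auto
  next
    assume "\<exists>k<card A. greedy_pick A v c (greedy_set A v c k) = i
        \<and> v (greedy_set A v c (Suc k)) \<le> \<alpha> * opt A v c B"
    then obtain k where k: "k < card A" "greedy_pick A v c (greedy_set A v c k) = i"
      "v (greedy_set A v c (Suc k)) \<le> \<alpha> * opt A v c B" by blast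
    have "k < m"
    proof (rule ccontr)
      assume "\<not> k < m"
      \<comment> \<open>The first rejected set would be contained in one that passes the
        test.\<close>
      then have "v (greedy_set A v c (Suc m)) \<le> v (greedy_set A v c (Suc k))"
        using k(1) by (intro v_mono greedy_set_mono greedy_set_subset) auto
      then show False using k m(4) \<open>\<not> k < m\<close> by simp
    qed
    then have "greedy_set A v c (Suc k) \<subseteq> greedy_set A v c m" by (intro greedy_set_mono) simp
    then show "i \<in> greedy_eom \<alpha> A v B c" using k(2) m(2) by auto
  qed
qed

lemma greedy_eom_subset: "greedy_eom \<alpha> A v B c \<subseteq> A"
  using greedy_eom_prefix[of \<alpha> B c] greedy_set_subset by auto

text \<open>With the lower bid \<open>i\<close> is picked on top of a smaller set and tested against
  a larger optimum, so it passes the test again.\<close>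

lemma greedy_eom_monotone:
  assumes "0 \<le> B" "0 \<le> \<alpha>" "0 \<le> c i" "c i \<le> b" "i \<in> greedy_eom \<alpha> A v B (c(i := b))"
  shows "i \<in> greedy_eom \<alpha> A v B c"
proof -
  let ?c' = "c(i := b)"
  obtain l where l: "l < card A" "greedy_pick A v ?c' (greedy_set A v ?c' l) = i"
    "v (greedy_set A v ?c' (Suc l)) \<le> \<alpha> * opt A v ?c' B"
    using assms(5) greedy_eom_iff by blast
  obtain k where k: "k \<le> l" "greedy_pick A v c (greedy_set A v c k) = i"
    "greedy_set A v c k \<subseteq> greedy_set A v ?c' l"
    using greedy_position_upd[OF assms(3,4) l(1,2)] by blast
  have "v (greedy_set A v c (Suc k)) \<le> v (greedy_set A v ?c' (Suc l))"
    using l k by (intro v_mono greedy_set_subset) auto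
  also have "\<dots> \<le> \<alpha> * opt A v ?c' B" by (rule l(3))
  also have "\<dots> \<le> \<alpha> * opt A v c B"
    using assms by (intro mult_left_mono opt_antimono) auto
  finally show ?thesis using k l by (auto simp: greedy_eom_iff intro!: exI[of _ k])
qed

section \<open>Payments of the greedy rule\<close>

text \<open>The right side refers only to the run with the original costs and is free of
  \<open>b\<close>, so the bounds for different winners can be summed.\<close>

lemma greedy_winning_bid_le:
  assumes B: "0 \<le> B" and c: "c \<in> cost_vectors A" and b: "c i \<le> b" and opt: "0 < opt A v c B"
    and k: "k < card A" "greedy_pick A v c (greedy_set A v c k) = i"
    and win: "i \<in> greedy_eom (1 / 2) A v B (c(i := b))"
  shows "b \<le> 2 * B / opt A v c B * marginal v i (greedy_set A v c k)"
proof -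
  let ?c' = "c(i := b)" and ?opt = "opt A v c B"
  have i: "i \<in> A" "i \<notin> greedy_set A v c k" 
    using greedy_set_pick[OF k(1), of c] k(2) by auto
  then have ci: "0 \<le> c i" using c by (auto simp: cost_vectors_def)
  obtain l where l: "l < card A" "greedy_pick A v ?c' (greedy_set A v ?c' l) = i"
    "v (greedy_set A v ?c' (Suc l)) \<le> 1 / 2 * opt A v ?c' B"
    using win greedy_eom_iff by blast
  define T where "T = greedy_set A v ?c' l"
  define m where "m = marginal v i T"
  have T: "T \<subset> A" "i \<notin> T"
    using greedy_set_psubset[OF l(1), of ?c'] greedy_set_pick[OF l(1), of ?c'] l(2)
    by (auto simp: T_def)
  have m0: "0 \<le> m" unfolding m_def using T i by (intro marginal_nonneg) auto
  have "opt A v ?c' B \<le> ?opt" using B b by (intro opt_antimono) auto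
  with l(3) have half: "v T + m \<le> ?opt / 2" using l(2) by (simp add: T_def m_def marginal_def)
  \<comment> \<open>Taking \<open>X\<close> optimal for \<open>c\<close>, not for the raised costs,
    brings in the original optimum instead of the possibly smaller one.\<close>
  obtain X where X: "X \<subseteq> A" "sum c X \<le> B" "?opt = v X" using opt_attained B .
  have finX: "finite X" using X fin finite_subset by blast
  have "v X \<le> v T + (\<Sum>j\<in>X - T. marginal v j T)" using T X by (intro v_le_sum_marginal) auto
  \<comment> \<open>Whether or not \<open>i\<close> is in \<open>X\<close>, its share is at most
    \<open>m\<close>, which \<open>half\<close> already accounts for; the remaining sellers have the
    same cost in \<open>c\<close> and \<open>?c'\<close>.\<close>
  also have "(\<Sum>j\<in>X - T. marginal v j T) \<le> (\<Sum>j\<in>insert i (X - T - {i}). marginal v j T)"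
    using T X i finX by (intro sum_mono2 marginal_nonneg) auto
  also have "\<dots> = m + (\<Sum>j\<in>X - T - {i}. marginal v j T)" using finX by (subst sum.insert) (auto simp: m_def)
  finally have "?opt / 2 \<le> (\<Sum>j\<in>X - T - {i}. marginal v j T)" using X half by simp
  have ratio: "ratio v ?c' T j \<le> ratio v ?c' T i" if "j \<in> A - T" for j
    using greedy_pick(2)[of T j ?c'] that T l(2) by (simp add: T_def)
  \<comment> \<open>The greedy choice of \<open>i\<close>, cross-multiplied so that zero costs and
    zero marginal values are covered too.\<close>
  have "b * marginal v j T \<le> c j * m" if j: "j \<in> X - T - {i}" for j
  proof -
    have cj: "0 \<le> c j" "j \<in> A" using j X c by (auto simp: cost_vectors_def)
    have "0 \<le> marginal v j T" using T cj by (intro marginal_nonneg) auto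
    moreover have "ratio v ?c' T j \<le> ratio v ?c' T i" using j X by (intro ratio) auto
    ultimately show ?thesis
      using j cj ci b m0
      by (auto simp: ratio_def m_def[symmetric] field_simps split: if_splits)
  qed
  then have "(\<Sum>j\<in>X - T - {i}. b * marginal v j T) \<le> (\<Sum>j\<in>X - T - {i}. c j * m)"
    by (rule sum_mono)
  also have "\<dots> \<le> (\<Sum>j\<in>X. c j * m)"
    using finX X c m0 by (intro sum_mono2) (auto simp: cost_vectors_def)
  also have "\<dots> \<le> B * m" using X m0 by (simp add: sum_distrib_right[symmetric] mult_right_mono)
  finally have "b * (\<Sum>j\<in>X - T - {i}. marginal v j T) \<le> B * m" by (simp add: sum_distrib_left)
  moreover have "b * (?opt / 2) \<le> b * (\<Sum>j\<in>X - T - {i}. marginal v j T)"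
    using \<open>?opt / 2 \<le> _\<close> ci b by (intro mult_left_mono) auto
  ultimately have "b * (?opt / 2) \<le> B * m" by simp
  moreover have "m \<le> marginal v i (greedy_set A v c k)"
  proof -
    obtain k' where k': "k' \<le> l" "greedy_pick A v c (greedy_set A v c k') = i"
      "greedy_set A v c k' \<subseteq> T"
      unfolding T_def using greedy_position_upd[OF ci b l(1,2)] by blast
    \<comment> \<open>As \<open>i\<close> is still missing from the set with index \<open>k\<close>,
      it cannot have been picked earlier.\<close>
    have "k \<le> k'" using i(2) k'(2) greedy_set_mono[of "Suc k'" k c] not_less_eq_eq by auto
    then have "greedy_set A v c k \<subseteq> T" using greedy_set_mono k' by blast
    then show ?thesis unfolding m_def using T i by (intro marginal_antimono) auto
  qed
  then have "B * m \<le> B * marginal v i (greedy_set A v c k)" using B by (rule mult_left_mono)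
  ultimately show ?thesis using opt by (simp add: field_simps)
qed

text \<open>The marginal values along the greedy order telescope.\<close>

lemma sum_greedy_set_le:
  assumes "\<And>k. k < m \<Longrightarrow> p (greedy_pick A v c (greedy_set A v c k))
      \<le> K * marginal v (greedy_pick A v c (greedy_set A v c k)) (greedy_set A v c k)"
    and "m \<le> card A"
  shows "sum p (greedy_set A v c m) \<le> K * (v (greedy_set A v c m) - v {})"
  using assms
proof (induction m)
  case (Suc m)
  let ?S = "greedy_set A v c m" and ?i = "greedy_pick A v c (greedy_set A v c m)"
  have S: "?S \<subset> A" using Suc.prems by (intro greedy_set_psubset) simp
  then have "finite ?S" using fin finite_subset by blast
  then have "sum p (greedy_set A v c (Suc m)) = p ?i + sum p ?S"
    using greedy_pick(1)[OF S, of c] by simp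
  also have "\<dots> \<le> K * marginal v ?i ?S + K * (v ?S - v {})"
    using Suc by (intro add_mono) auto
  also have "\<dots> = K * (v (greedy_set A v c (Suc m)) - v {})"
    by (simp add: marginal_def algebra_simps)
  finally show ?case .
qed simp

text \<open>The function \<open>p\<close> is kept abstract because the payments are thresholds of
  the full rule, which also discards sellers above \<open>B\<close>. All that is assumed is that
  \<open>p i\<close> respects every upper bound on the winning bids from \<open>c i\<close>
  upwards.\<close>

lemma greedy_payments_le:
  assumes B: "0 \<le> B" and c: "c \<in> cost_vectors A" and opt: "0 < opt A v c B" and v0: "0 \<le> v {}"
    and p: "\<And>i X. i \<in> greedy_eom (1 / 2) A v B c \<Longrightarrow>
      (\<And>b. c i \<le> b \<Longrightarrow> i \<in> greedy_eom (1 / 2) A v B (c(i := b)) \<Longrightarrow> b \<le> X) \<Longrightarrow> p i \<le> X"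
  shows "sum p (greedy_eom (1 / 2) A v B c) \<le> B"
proof -
  let ?opt = "opt A v c B"
  obtain m where m: "m \<le> card A" "greedy_eom (1 / 2) A v B c = greedy_set A v c m"
    "\<And>k. 1 \<le> k \<Longrightarrow> k \<le> m \<Longrightarrow> v (greedy_set A v c k) \<le> 1 / 2 * ?opt"
    "m < card A \<Longrightarrow> 1 / 2 * ?opt < v (greedy_set A v c (Suc m))"
    using greedy_eom_prefix[of "1 / 2" B c] by blast
  have "sum p (greedy_set A v c m) \<le> 2 * B / ?opt * (v (greedy_set A v c m) - v {})"
  proof (rule sum_greedy_set_le)
    fix k assume "k < m"
    then have "greedy_set A v c (Suc k) \<subseteq> greedy_eom (1 / 2) A v B c"
      using greedy_set_mono[of "Suc k" m c] m(2) by simp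
    then show "p (greedy_pick A v c (greedy_set A v c k))
      \<le> 2 * B / ?opt * marginal v (greedy_pick A v c (greedy_set A v c k)) (greedy_set A v c k)"
      using \<open>k < m\<close> m(1) by (intro p greedy_winning_bid_le[OF B c _ opt]) auto
  qed (rule m(1))
  also have "\<dots> \<le> 2 * B / ?opt * (1 / 2 * ?opt)"
  proof (intro mult_left_mono)
    \<comment> \<open>For \<open>m = 0\<close> the loop gives no bound, but then the difference is
      \<open>0\<close>; for larger \<open>m\<close>, dropping \<open>v {}\<close> is harmless since
      it is nonnegative.\<close>
    show "v (greedy_set A v c m) - v {} \<le> 1 / 2 * ?opt"
      using m(3)[of m] v0 opt by (cases m) auto
  qed (use B opt in auto)
  also have "\<dots> = B" using opt by simp
  finally show ?thesis using m(2) by simp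
qed

section \<open>Approximation\<close>

text \<open>Either greedy takes all sellers and thus reaches the optimum, or the item it rejects
  closes the gap to half the optimum, and by submodularity its marginal value is at most
  \<open>v {x}\<close>.\<close>

lemma opt_le_greedy_plus_best:
  assumes "0 \<le> B" "\<And>S. S \<subseteq> A \<Longrightarrow> 0 \<le> v S" and x: "x \<in> A" "\<And>i. i \<in> A \<Longrightarrow> v {i} \<le> v {x}"
  shows "opt A v c B \<le> 2 * (v (greedy_eom (1 / 2) A v B c) + v {x})"
proof -
  obtain m where m: "m \<le> card A" "greedy_eom (1 / 2) A v B c = greedy_set A v c m"
    "\<And>k. 1 \<le> k \<Longrightarrow> k \<le> m \<Longrightarrow> v (greedy_set A v c k) \<le> 1 / 2 * opt A v c B"
    "m < card A \<Longrightarrow> 1 / 2 * opt A v c B < v (greedy_set A v c (Suc m))"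
    using greedy_eom_prefix[of "1 / 2" B c] by blast
  show ?thesis
  proof (cases "m = card A")
    case True
    obtain S where "S \<subseteq> A" "opt A v c B = v S" using opt_attained assms(1) .
    then have "opt A v c B \<le> v A" by (simp add: v_mono)
    moreover have "0 \<le> v A" "0 \<le> v {x}" using assms by auto
    ultimately show ?thesis using m(2) True by (simp add: greedy_set_card)
  next
    case False
    let ?S = "greedy_set A v c m" and ?i = "greedy_pick A v c (greedy_set A v c m)"
    have S: "?S \<subset> A" using False m(1) by (intro greedy_set_psubset) simp
    have i: "?i \<in> A" using greedy_pick(1)[OF S, of c] by simp
    have "marginal v ?i ?S \<le> marginal v ?i {}" using S i by (intro marginal_antimono) auto
    also have "\<dots> \<le> v {x}" using x(2)[OF i] assms(2)[of "{}"] by (simp add: marginal_def)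
    finally show ?thesis using m False by (simp add: marginal_def)
  qed
qed

end

section \<open>The random mechanism\<close>

locale random_eom_setting = monotone_submodular +
  fixes B :: real and best :: "'a::linorder set \<Rightarrow> 'a"
  assumes B_pos: "0 < B"
    and v_nonneg: "\<And>S. S \<subseteq> A \<Longrightarrow> 0 \<le> v S"
    and best: "best_single A v best"
begin

abbreviation rule_of :: "bool \<Rightarrow> 'a rule" where
  "rule_of \<equiv> random_eom_rule (1 / 2) A v B best"

abbreviation affordable :: "('a \<Rightarrow> real) \<Rightarrow> 'a set" where
  "affordable c \<equiv> {i \<in> A. c i \<le> B}"

lemma best_in:
  assumes "X \<subseteq> A" "X \<noteq> {}"
  shows "best X \<in> X" "i \<in> X \<Longrightarrow> v {i} \<le> v {best X}"
  using best assms by (auto simp: best_single_def is_arg_max_def not_less)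

lemma affordable_ms: "monotone_submodular (affordable c) v"
  by (rule restrict) auto

lemma rule_of_subset: "rule_of coin c \<subseteq> affordable c"
  using monotone_submodular.greedy_eom_subset[OF affordable_ms] best_in(1)[of "affordable c"]
  by (auto simp: random_eom_rule_def Let_def split: if_splits dest!: subsetD)

lemma affordable_upd: "c i \<le> B \<Longrightarrow> b \<le> B \<Longrightarrow> affordable (c(i := b)) = affordable c"
  by auto

lemma winning_bid_le: "i \<in> rule_of coin (c(i := b)) \<Longrightarrow> b \<le> B"
  using rule_of_subset[of coin "c(i := b)"] by auto

text \<open>A winning bid is at most \<open>B\<close>, so both bids leave the same sellers
  affordable. Greedy then runs on one fixed set, and \<open>best\<close>, depending on that set
  alone, makes the same choice.\<close>

lemma rule_of_monotone:
  assumes c: "c \<in> cost_vectors A" and i: "i \<in> A" and b: "c i \<le> b" and win: "i \<in> rule_of coin (c(i := b))"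
  shows "i \<in> rule_of coin c"
proof -
  have bB: "b \<le> B" using winning_bid_le win .
  then have ciB: "c i \<le> B" using b by simp
  have eq: "affordable (c(i := b)) = affordable c" using bB ciB by (intro affordable_upd)
  have ne: "affordable c \<noteq> {}" using i ciB by auto
  show ?thesis
  proof (cases coin)
    case True
    have "i \<in> greedy_eom (1 / 2) (affordable c) v B (c(i := b))"
      using win True ne by (simp only: random_eom_rule_def Let_def eq if_True if_False)
    then have "i \<in> greedy_eom (1 / 2) (affordable c) v B c"
      using monotone_submodular.greedy_eom_monotone[OF affordable_ms] B_pos b c i
      by (simp add: cost_vectors_def)
    then show ?thesis using True ne by (simp only: random_eom_rule_def Let_def if_True if_False)
  next
    case False
    then show ?thesis using win ne by (simp only: random_eom_rule_def Let_def eq if_True if_False)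
  qed
qed

lemma truthful_rule_of: "truthful A (with_threshold_payments (rule_of coin))"
proof (rule truthful_with_threshold_payments)
  show "i \<in> rule_of coin c"
    if "c \<in> cost_vectors A" "i \<in> A" "c i \<le> b" "i \<in> rule_of coin (c(i := b))" for c i b
    using that by (rule rule_of_monotone)
  show "\<exists>b\<ge>0. i \<notin> rule_of coin (c(i := b))" for c i
    using winning_bid_le[of i coin c "B + 1"] B_pos by (intro exI[of _ "B + 1"]) auto
qed

lemma threshold_le_B:
  assumes "c \<in> cost_vectors A"
  shows "threshold_payment (rule_of coin) c i \<le> B"
proof (cases "i \<in> rule_of coin c")
  case True
  moreover have "0 \<le> c i" using rule_of_subset True assms by (fastforce simp: cost_vectors_def)
  ultimately show ?thesis using winning_bid_le by (intro threshold_payment_le)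
next
  case False
  then show ?thesis using B_pos by (simp add: threshold_payment_def)
qed

text \<open>Serves the single-item rule and the degenerate cases of the greedy rule, where no seller
  is affordable or the optimum is \<open>0\<close>.\<close>

lemma budget_single_winner:
  assumes c: "c \<in> cost_vectors A" and "rule_of coin c \<subseteq> {x}"
  shows "(\<Sum>i\<in>A. threshold_payment (rule_of coin) c i) \<le> B"
proof -
  have "(\<Sum>i\<in>A. threshold_payment (rule_of coin) c i)
      = (\<Sum>i\<in>A. if i = x then threshold_payment (rule_of coin) c x else 0)"
    using assms(2) by (intro sum.cong) (auto simp: threshold_payment_def)
  also have "\<dots> \<le> B" using threshold_le_B[OF c, of coin x] B_pos fin by simp
  finally show ?thesis .
qed

text \<open>The greedy payment bound divides by the optimum, so a zero optimum is treated apart: all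
  affordable sellers are then worthless, hence at most one can win, and it is paid at most
  \<open>B\<close>.\<close>

lemma budget_rule_of:
  assumes c: "c \<in> cost_vectors A" and worthless: "card {i \<in> A. v {i} = 0} \<le> 1"
  shows "(\<Sum>i\<in>A. threshold_payment (rule_of coin) c i) \<le> B"
proof (cases "affordable c = {} \<or> \<not> coin")
  case True
  then have "rule_of coin c \<subseteq> {best (affordable c)}" by (auto simp: random_eom_rule_def Let_def)
  with c show ?thesis by (rule budget_single_winner)
next
  case False
  let ?A = "affordable c" and ?p = "threshold_payment (rule_of coin) c"
  interpret A': monotone_submodular ?A v by (rule affordable_ms)
  have c': "c \<in> cost_vectors ?A" using c by (auto simp: cost_vectors_def)
  have rule: "rule_of coin c = greedy_eom (1 / 2) ?A v B c"
    using False by (auto simp: random_eom_rule_def Let_def)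
  show ?thesis
  proof (cases "0 < opt ?A v c B")
    case True
    have "(\<Sum>i\<in>A. ?p i) = (\<Sum>i\<in>greedy_eom (1 / 2) ?A v B c. ?p i)"
      using A'.greedy_eom_subset fin rule
      by (intro sum.mono_neutral_right) (auto simp: threshold_payment_def)
    also have "\<dots> \<le> B"
    proof (rule A'.greedy_payments_le)
      fix i X
      assume i: "i \<in> greedy_eom (1 / 2) ?A v B c"
        and bound: "\<And>b. c i \<le> b \<Longrightarrow> i \<in> greedy_eom (1 / 2) ?A v B (c(i := b)) \<Longrightarrow> b \<le> X"
      have iA: "i \<in> A" "c i \<le> B" using i A'.greedy_eom_subset by auto
      show "?p i \<le> X"
      proof (rule threshold_payment_le)
        fix b assume "c i \<le> b" and win: "i \<in> rule_of coin (c(i := b))"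
        \<comment> \<open>Winning bids do not exceed \<open>B\<close>, which turns a win under the
          full rule into a win of greedy on the fixed set \<open>?A\<close>.\<close>
        have eq: "affordable (c(i := b)) = ?A" using winning_bid_le[OF win] iA by (intro affordable_upd)
        have "i \<in> greedy_eom (1 / 2) ?A v B (c(i := b))"
          using win False by (simp only: random_eom_rule_def Let_def eq if_True if_False de_Morgan_disj not_not)
        with \<open>c i \<le> b\<close> show "b \<le> X" by (rule bound)
      qed (use i rule c iA in \<open>auto simp: cost_vectors_def\<close>)
    qed (use B_pos c' True v_nonneg in auto)
    finally show ?thesis .
  next
    case False
    have "v {i} = 0" if "i \<in> ?A" for i
      using A'.opt_ge[of "{i}" c B] that False v_nonneg[of "{i}"] by simp
    then have "?A \<subseteq> {i \<in> A. v {i} = 0}" by auto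
    moreover have "a = b" if "a \<in> {i \<in> A. v {i} = 0}" "b \<in> {i \<in> A. v {i} = 0}" for a b
      using worthless card_le_Suc0_iff_eq[of "{i \<in> A. v {i} = 0}"] fin that by simp
    ultimately obtain x where "?A \<subseteq> {x}" by blast
    with rule_of_subset[of coin c] have "rule_of coin c \<subseteq> {x}" by (rule order_trans)
    with c show ?thesis by (rule budget_single_winner)
  qed
qed

text \<open>Each outcome of the coin has probability \<open>1 / 2\<close>, so the right side is four
  times the expected value.\<close>

lemma approx_rule_of:
  assumes c: "c \<in> cost_vectors A"
  shows "opt A v c B \<le> 2 * (v (rule_of True c) + v (rule_of False c))"
proof -
  let ?A = "affordable c"
  interpret A': monotone_submodular ?A v by (rule affordable_ms)
  have opt: "opt A v c B = opt ?A v c B" using opt_affordable[OF c] by simp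
  show ?thesis
  proof (cases "?A = {}")
    case True
    obtain S where "S \<subseteq> ?A" "opt ?A v c B = v S" using A'.opt_attained[OF less_imp_le[OF B_pos]] .
    then have "opt A v c B = v {}" using opt True by auto
    then show ?thesis using True v_nonneg[of "{}"] by (simp add: random_eom_rule_def)
  next
    case False
    then have "opt ?A v c B \<le> 2 * (v (greedy_eom (1 / 2) ?A v B c) + v {best ?A})"
      using best_in[of ?A] B_pos v_nonneg by (intro A'.opt_le_greedy_plus_best) auto
    then show ?thesis using opt False by (simp only: random_eom_rule_def Let_def if_True if_False)
  qed
qed

end

theorem corollary3p9:
  fixes A :: "'a::linorder set" and v :: "'a set \<Rightarrow> real" and B :: real
    and best :: "'a set \<Rightarrow> 'a"
  assumes "finite A"
    and "B > 0"
    and "\<And>S. S \<subseteq> A \<Longrightarrow> 0 \<le> v S"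
    and "mono_on (Pow A) v"
    and "submodular_on A v"
    and "best_single A v best"
  defines "R \<equiv> map_pmf with_threshold_payments (random_eom (1 / 2) A v B best)"
  shows "universally_truthful A R
    \<and> (card {i \<in> A. v {i} = 0} \<le> 1 \<longrightarrow> budget_feasible A B R)
    \<and> approximates_opt 4 A v B R"
proof -
  interpret random_eom_setting A v B best
    using assms by unfold_locales auto
  have R: "R = map_pmf (\<lambda>coin. with_threshold_payments (rule_of coin)) (bernoulli_pmf (1 / 2))"
    by (simp add: R_def random_eom_def pmf.map_comp o_def)
  have "universally_truthful A R"
    using truthful_rule_of by (auto simp: universally_truthful_def R)
  moreover have "budget_feasible A B R" if "card {i \<in> A. v {i} = 0} \<le> 1"
    using budget_rule_of that by (auto simp: budget_feasible_def R with_threshold_payments_def)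
  moreover have "approximates_opt 4 A v B R"
    using approx_rule_of by (auto simp: approximates_opt_def R with_threshold_payments_def algebra_simps)
  ultimately show ?thesis by blast
qed

end
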